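(* Let $m\ge 2$ be an integer and $p\in(0,1)$, and let $\{G_t\}$ be the sequence of random graphs generated by the Holme-Kim model with parameters $m$ and $p$. Then there exist constants $b_1,b_2>0$ depending only on $m$ and $p$ such that the global clustering coefficients $\mathcal{C}^{glo}_{G_t}$ satisfy \[\lim_{t\to+\infty}\mathbb{P}\left(\frac{b_1}{\log t}\le \mathcal{C}^{glo}_{G_t}\le\frac{b_2}{\log t}\right)=1.\]
   Context: Graph notation. Graphs are finite and may have multiple edges (and, only at vertex $1$ in the model below, self-loops). $e_G(v,w)$ is the number of edges between $v$ and $w$ (each self-loop at $v$ contributes $2$ to $e_G(v,v)$); $v$ and $w$ are neighbors if $e_G(v,w)\ge 1$; $\Gamma_G(v)$ is the set of neighbors of $v$; $d_G(v)=\sum_{w\in\Gamma_G(v)}e_G(v,w)$ is the degree. For $G=G_t$ the subscript $G_t$ is abbreviated to $t$. Holme-Kim model. Parameters: an integer $m\ge2$ and $p\in[0,1]$. $G_1$ has vertex set $V_1=\{1\}$ and $m$ self-loops at vertex $1$ (so $d_1(1)=e_1(1,1)=2m$). For $t\ge1$, $G_{t+1}$ is obtained from $G_t$ (vertex set $V_t=\{1,\dots,t\}$) by adding a vertex $t+1$ and $m$ edges from $t+1$ to random vertices $Y^{(1)}_{t+1},\dots,Y^{(m)}_{t+1}\in V_t$ (repetitions allowed), chosen sequentially. Let $\mathcal{F}_t$ be the $\sigma$-field generated by all random choices up to time $t$, let $\mathcal{F}^{(i-1)}_t$ be the $\sigma$-field generated by $\mathcal{F}_t$ and all subsequent random choices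 made in choosing $Y^{(j)}_{t+1}$, $1\le j\le i-1$, and let $\xi^{(i)}_{t+1}$ be i.i.d. Bernoulli$(p)$ variables, with fresh coins independent of the past. Then $\mathbb{P}(Y^{(1)}_{t+1}=u\mid\mathcal{F}_t)=\frac{d_t(u)}{2mt}$ for $u\in V_t$, and for $2\le i\le m$: given $\mathcal{F}^{(i-1)}_t$ and $\xi^{(i)}_{t+1}=0$, $Y^{(i)}_{t+1}=u$ with probability $\frac{d_t(u)}{2mt}$ ($u\in V_t$); given $\mathcal{F}^{(i-1)}_t$ and $\xi^{(i)}_{t+1}=1$, $Y^{(i)}_{t+1}=u$ with probability $\frac{e_t(Y^{(i-1)}_{t+1},u)}{d_t(Y^{(i-1)}_{t+1})}$ if $u\in\Gamma_t(Y^{(i-1)}_{t+1})$ and $0$ otherwise. Clustering. A triangle in $G$ is a set of three distinct vertices that are pairwise neighbors; $\Delta_G$ is the number of triangles in $G$. The number of cherries, counted with edge multiplicities, is $C_G=\sum_{v\in V_G}\binom{d_G(v)}{2}$. The global clustering coefficient is $\mathcal{C}^{glo}_G=3\,\Delta_G/C_G$. *)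

theory Defs
  imports "HOL-Probability.Probability"
begin

section \<open>Finite multigraphs\<close>

text \<open>
  A multigraph is a vertex set with a multiplicity function: \<open>emult G v w\<close> is the number \<open>e\<^sub>G(v,w)\<close>
  of edges between \<open>v\<close> and \<open>w\<close>, where a self-loop at \<open>v\<close> contributes 2 to \<open>emult G v v\<close>.
  Finiteness and symmetry are not part of the type; the graphs of the model have both
  (lemma \<open>hk_graph_wf\<close> below).
\<close>

record multigraph =
  verts :: "nat set"
  emult :: "nat \<Rightarrow> nat \<Rightarrow> nat"

definition neighbors :: "multigraph \<Rightarrow> nat \<Rightarrow> nat set" where
  "neighbors G v = {w \<in> verts G. emult G v w \<ge> 1}"

definition vdegree :: "multigraph \<Rightarrow> nat \<Rightarrow> nat" where
  "vdegree G v = (\<Sum>w\<in>neighbors G v. emult G v w)"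

definition triangles :: "multigraph \<Rightarrow> nat set set" where
  "triangles G = {T. T \<subseteq> verts G \<and> card T = 3 \<and> (\<forall>v\<in>T. \<forall>w\<in>T. v \<noteq> w \<longrightarrow> w \<in> neighbors G v)}"

definition cherries :: "multigraph \<Rightarrow> nat" where
  "cherries G = (\<Sum>v\<in>verts G. vdegree G v choose 2)"

definition global_clustering :: "multigraph \<Rightarrow> real" where
  "global_clustering G = 3 * real (card (triangles G)) / real (cherries G)"


section \<open>The Holme--Kim model\<close>

definition initial_graph :: "nat \<Rightarrow> multigraph" where
  "initial_graph m = \<lparr>verts = {1}, emult = (\<lambda>v w. if v = 1 \<and> w = 1 then 2 * m else 0)\<rparr>"

text \<open>
  Add a vertex \<open>v\<close> with one edge to each entry of the list \<open>ys\<close>; repeated entries give multiple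
  edges. In the model, \<open>v\<close> is new and does not occur in \<open>ys\<close>.
\<close>

definition add_vertex :: "nat \<Rightarrow> nat list \<Rightarrow> multigraph \<Rightarrow> multigraph" where
  "add_vertex v ys G =
     \<lparr>verts = insert v (verts G),
      emult = (\<lambda>x y. emult G x y + (if x = v then count_list ys y else 0)
                                + (if y = v then count_list ys x else 0))\<rparr>"

text \<open>
  \<open>embed_pmf\<close> is meaningful only for weights that are nonnegative and sum to 1. For the graphs
  of the model this is shown below (lemmas \<open>pmf_pref_choice\<close> and \<open>pmf_triad_choice\<close>).
\<close>

definition pref_choice :: "nat \<Rightarrow> nat \<Rightarrow> multigraph \<Rightarrow> nat pmf" where
  "pref_choice m t G =
     embed_pmf (\<lambda>u. if u \<in> verts G then real (vdegree G u) / real (2 * m * t) else 0)"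

definition triad_choice :: "multigraph \<Rightarrow> nat \<Rightarrow> nat pmf" where
  "triad_choice G y =
     embed_pmf (\<lambda>u. if u \<in> neighbors G y then real (emult G y u) / real (vdegree G y) else 0)"

text \<open>The choice of \<open>Y\<^bsup>(i)\<^esup>\<close> for \<open>i \<ge> 2\<close>, where \<open>y\<close> is the value of \<open>Y\<^bsup>(i-1)\<^esup>\<close>: a fresh coin
  decides between a triad formation step and a preferential attachment step.\<close>

definition next_choice :: "nat \<Rightarrow> real \<Rightarrow> nat \<Rightarrow> multigraph \<Rightarrow> nat \<Rightarrow> nat pmf" where
  "next_choice m p t G y =
     bind_pmf (bernoulli_pmf p) (\<lambda>\<xi>. if \<xi> then triad_choice G y else pref_choice m t G)"

primrec further_choices :: "nat \<Rightarrow> real \<Rightarrow> nat \<Rightarrow> multigraph \<Rightarrow> nat \<Rightarrow> nat \<Rightarrow> nat list pmf" where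
  "further_choices m p t G 0 y = return_pmf []"
| "further_choices m p t G (Suc n) y =
     bind_pmf (next_choice m p t G y) (\<lambda>z.
     bind_pmf (further_choices m p t G n z) (\<lambda>zs.
     return_pmf (z # zs)))"

text \<open>The joint law of the list \<open>Y\<^bsup>(1)\<^esup>, \<dots>, Y\<^bsup>(m)\<^esup>\<close> (for \<open>m \<ge> 1\<close>), given the current graph.\<close>

definition choices :: "nat \<Rightarrow> real \<Rightarrow> nat \<Rightarrow> multigraph \<Rightarrow> nat list pmf" where
  "choices m p t G =
     bind_pmf (pref_choice m t G) (\<lambda>y.
     bind_pmf (further_choices m p t G (m - 1) y) (\<lambda>ys.
     return_pmf (y # ys)))"

definition hk_step :: "nat \<Rightarrow> real \<Rightarrow> nat \<Rightarrow> multigraph \<Rightarrow> multigraph pmf" where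
  "hk_step m p t G = map_pmf (\<lambda>ys. add_vertex (t + 1) ys G) (choices m p t G)"

text \<open>The law of \<open>G\<^sub>t\<close>. Time starts at 1; the value at index 0 is a dummy.\<close>

fun hk_graph :: "nat \<Rightarrow> real \<Rightarrow> nat \<Rightarrow> multigraph pmf" where
  "hk_graph m p 0 = return_pmf (initial_graph m)"
| "hk_graph m p (Suc 0) = return_pmf (initial_graph m)"
| "hk_graph m p (Suc (Suc t)) = bind_pmf (hk_graph m p (Suc t)) (hk_step m p (Suc t))"


section \<open>Well-formedness of the model\<close>

definition hk_wf :: "nat \<Rightarrow> nat \<Rightarrow> multigraph \<Rightarrow> bool" where
  "hk_wf m t G \<longleftrightarrow> verts G = {1..t} \<and> (\<forall>v w. emult G v w = emult G w v) \<and>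
     (\<forall>v w. emult G v w \<noteq> 0 \<longrightarrow> v \<in> verts G \<and> w \<in> verts G) \<and>
     (\<forall>v\<in>verts G. vdegree G v \<ge> 1) \<and> (\<Sum>v\<in>verts G. vdegree G v) = 2 * m * t"

lemma vdegree_eq_sum_verts:
  assumes "finite (verts G)"
  shows "vdegree G v = (\<Sum>w\<in>verts G. emult G v w)"
  unfolding vdegree_def neighbors_def
  by (rule sum.mono_neutral_left) (use assms in auto)

lemma pmf_embed_finite:
  fixes f :: "'a \<Rightarrow> real"
  assumes "finite A" "\<And>x. x \<in> A \<Longrightarrow> f x \<ge> 0" "sum f A = 1"
  shows "pmf (embed_pmf (\<lambda>x. if x \<in> A then f x else 0)) x = (if x \<in> A then f x else 0)"
proof (rule pmf_embed_pmf)
  show "0 \<le> (if x \<in> A then f x else 0)" for x using assms by auto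
  have "(\<integral>\<^sup>+ x. ennreal (if x \<in> A then f x else 0) \<partial>count_space UNIV)
      = (\<integral>\<^sup>+ x. ennreal (f x) * indicator A x \<partial>count_space UNIV)"
    by (rule nn_integral_cong) (auto simp: indicator_def)
  also have "\<dots> = (\<integral>\<^sup>+ x. ennreal (f x) \<partial>count_space A)"
    by (simp add: nn_integral_count_space_indicator)
  also have "\<dots> = (\<Sum>x\<in>A. ennreal (f x))"
    using assms by (simp add: nn_integral_count_space_finite)
  also have "\<dots> = ennreal (sum f A)" using assms by (simp add: sum_ennreal)
  finally show "(\<integral>\<^sup>+ x. ennreal (if x \<in> A then f x else 0) \<partial>count_space UNIV) = 1"
    using assms by simp
qed

lemma pmf_pref_choice:
  assumes "hk_wf m t G" "m \<ge> 1" "t \<ge> 1"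
  shows "pmf (pref_choice m t G) u =
           (if u \<in> verts G then real (vdegree G u) / real (2 * m * t) else 0)"
  unfolding pref_choice_def
proof (rule pmf_embed_finite)
  have "(\<Sum>u\<in>verts G. real (vdegree G u)) = real (2 * m * t)"
    using assms unfolding hk_wf_def by (metis of_nat_sum)
  then show "(\<Sum>u\<in>verts G. real (vdegree G u) / real (2 * m * t)) = 1"
    using assms by (simp flip: sum_divide_distrib)
qed (use assms in \<open>auto simp: hk_wf_def\<close>)

lemma pmf_triad_choice:
  assumes "hk_wf m t G" "y \<in> verts G"
  shows "pmf (triad_choice G y) u =
           (if u \<in> neighbors G y then real (emult G y u) / real (vdegree G y) else 0)"
  unfolding triad_choice_def
proof (rule pmf_embed_finite)
  have "vdegree G y \<ge> 1" using assms by (auto simp: hk_wf_def)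
  then show "(\<Sum>u\<in>neighbors G y. real (emult G y u) / real (vdegree G y)) = 1"
    by (simp add: vdegree_def flip: sum_divide_distrib of_nat_sum)
qed (use assms in \<open>auto simp: hk_wf_def neighbors_def\<close>)

lemma set_next_choice:
  assumes "hk_wf m t G" "m \<ge> 1" "t \<ge> 1" "y \<in> verts G"
  shows "set_pmf (next_choice m p t G y) \<subseteq> verts G"
  using pmf_pref_choice[OF assms(1-3)] pmf_triad_choice[OF assms(1,4)]
  by (auto simp: next_choice_def set_pmf_iff[where M = "pref_choice m t G"]
      set_pmf_iff[where M = "triad_choice G y"] neighbors_def split: if_splits)

lemma set_further_choices:
  assumes "hk_wf m t G" "m \<ge> 1" "t \<ge> 1" "y \<in> verts G"
    and "ys \<in> set_pmf (further_choices m p t G n y)"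
  shows "length ys = n \<and> set ys \<subseteq> verts G"
  using assms(4,5)
proof (induction n arbitrary: y ys)
  case (Suc n)
  then obtain z zs where z: "z \<in> set_pmf (next_choice m p t G y)"
    "zs \<in> set_pmf (further_choices m p t G n z)" "ys = z # zs" by auto
  with set_next_choice[OF assms(1-3) Suc.prems(1)] Suc.IH[of z zs] show ?case by auto
qed simp

lemma set_choices:
  assumes "hk_wf m t G" "m \<ge> 1" "t \<ge> 1" "ys \<in> set_pmf (choices m p t G)"
  shows "length ys = m \<and> set ys \<subseteq> verts G"
proof -
  from assms(4) obtain z zs where z: "z \<in> set_pmf (pref_choice m t G)"
    "zs \<in> set_pmf (further_choices m p t G (m - 1) z)" "ys = z # zs"
    by (auto simp: choices_def)
  have "z \<in> verts G"
    using z(1) pmf_pref_choice[OF assms(1-3)] by (auto simp: set_pmf_iff split: if_splits)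
  with set_further_choices[OF assms(1-3) _ z(2)] z(3) assms(2) show ?thesis by auto
qed

lemma hk_wf_initial: "m \<ge> 1 \<Longrightarrow> hk_wf m 1 (initial_graph m)"
  by (auto simp: hk_wf_def initial_graph_def vdegree_eq_sum_verts)

lemma hk_wf_add_vertex:
  assumes wf: "hk_wf m t G" and "m \<ge> 1" and len: "length ys = m" and sub: "set ys \<subseteq> verts G"
  shows "hk_wf m (t + 1) (add_vertex (t + 1) ys G)"
proof -
  let ?H = "add_vertex (t + 1) ys G"
  have V: "verts G = {1..t}" and fin: "finite (verts G)" using wf by (auto simp: hk_wf_def)
  have nv: "t + 1 \<notin> verts G" using V by auto
  have c0: "count_list ys x = 0" if "x \<notin> verts G" for x
    using that sub by (auto simp: count_list_0_iff)
  have m0: "emult G x y = 0" if "x \<notin> verts G \<or> y \<notin> verts G" for x y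
    using that wf unfolding hk_wf_def by metis
  have csum: "(\<Sum>x\<in>verts G. count_list ys x) = m"
    using sum_count_set[OF sub fin] len by simp
  have vsum: "(\<Sum>v\<in>verts G. vdegree G v) = 2 * m * t" using wf unfolding hk_wf_def by blast
  have VH: "verts ?H = insert (t + 1) (verts G)" by (simp add: add_vertex_def)
  have degH: "vdegree ?H v = emult ?H v (t + 1) + (\<Sum>w\<in>verts G. emult ?H v w)" for v
    using vdegree_eq_sum_verts[of ?H v] fin nv unfolding VH by simp
  have degold: "vdegree ?H v = vdegree G v + count_list ys v" if "v \<in> verts G" for v
  proof -
    have "v \<noteq> t + 1" using that nv by auto
    moreover have "(\<Sum>w\<in>verts G. emult ?H v w) = (\<Sum>w\<in>verts G. emult G v w)"
      by (rule sum.cong) (use nv \<open>v \<noteq> t + 1\<close> in \<open>auto simp: add_vertex_def\<close>)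
    moreover have "emult ?H v (t + 1) = count_list ys v"
      using nv m0[of v "t + 1"] \<open>v \<noteq> t + 1\<close> by (simp add: add_vertex_def)
    ultimately show ?thesis
      unfolding degH vdegree_eq_sum_verts[OF fin] by simp
  qed
  have degnew: "vdegree ?H (t + 1) = m"
  proof -
    have "(\<Sum>w\<in>verts G. emult ?H (t + 1) w) = (\<Sum>w\<in>verts G. count_list ys w)"
      by (rule sum.cong) (use nv m0 in \<open>auto simp: add_vertex_def\<close>)
    moreover have "emult ?H (t + 1) (t + 1) = 0" using nv c0 m0 by (simp add: add_vertex_def)
    ultimately show ?thesis
      using csum unfolding degH by simp
  qed
  have "(\<Sum>v\<in>verts ?H. vdegree ?H v) = m + (\<Sum>v\<in>verts G. vdegree G v + count_list ys v)"
    using fin nv degnew degold unfolding VH by simp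
  also have "\<dots> = 2 * m * (t + 1)"
    using csum vsum by (simp add: sum.distrib)
  finally have s: "(\<Sum>v\<in>verts ?H. vdegree ?H v) = 2 * m * (t + 1)" .
  have d: "\<forall>v\<in>verts ?H. vdegree ?H v \<ge> 1"
  proof
    fix v assume "v \<in> verts ?H"
    then consider "v = t + 1" | "v \<in> verts G" unfolding VH by blast
    then show "vdegree ?H v \<ge> 1"
    proof cases
      case 1
      then show ?thesis using degnew \<open>m \<ge> 1\<close> by simp
    next
      case 2
      then have "vdegree G v \<ge> 1" using wf unfolding hk_wf_def by blast
      then show ?thesis unfolding degold[OF 2] by simp
    qed
  qed
  have "verts ?H = {1..t + 1}" unfolding VH V by auto
  moreover have "\<forall>v w. emult ?H v w = emult ?H w v"
    using wf by (auto simp: add_vertex_def hk_wf_def)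
  moreover have "\<forall>v w. emult ?H v w \<noteq> 0 \<longrightarrow> v \<in> verts ?H \<and> w \<in> verts ?H"
  proof (intro allI impI)
    fix v w assume nz: "emult ?H v w \<noteq> 0"
    have "emult ?H v w = 0" if "v \<notin> verts ?H \<or> w \<notin> verts ?H"
      using that c0[of v] c0[of w] m0[of v w] unfolding VH by (auto simp: add_vertex_def)
    with nz show "v \<in> verts ?H \<and> w \<in> verts ?H" by metis
  qed
  ultimately show ?thesis using s d unfolding hk_wf_def by blast
qed

theorem hk_graph_wf:
  assumes "m \<ge> 1" "t \<ge> 1" "G \<in> set_pmf (hk_graph m p t)"
  shows "hk_wf m t G"
  using assms(2,3)
proof (induction t arbitrary: G rule: nat_induct_at_least)
  case base
  then show ?case using hk_wf_initial[OF assms(1)] by simp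
next
  case (Suc t)
  then obtain s where s: "t = Suc s" by (cases t) auto
  with Suc.prems obtain H where H: "H \<in> set_pmf (hk_graph m p t)"
    "G \<in> set_pmf (hk_step m p t H)" by auto
  then obtain ys where "ys \<in> set_pmf (choices m p t H)" "G = add_vertex (t + 1) ys H"
    by (auto simp: hk_step_def)
  with Suc.IH[OF H(1)] set_choices[of m t H ys p] hk_wf_add_vertex[of m t H ys] assms(1) Suc.hyps
  show ?case by auto
qed

end

theory Submission
  imports Defs
begin

text \<open>
  The number of triangles is of order \<open>t\<close> and the number of cherries is of order \<open>t ln t\<close>, both
  with probability tending to 1; their quotient is then of order \<open>1 / ln t\<close>.

  Triangles. All edges added in one step meet the new vertex, so a step creates at most \<open>m\<^sup>2\<close>
  triangles, and the upper bound is deterministic (\<open>card_triangles_le\<close>). A triad step at the second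
  choice closes a triangle unless it repeats the first choice. A repetition uses a loop, and all
  loops are the \<open>m\<close> initial ones, so it costs at most \<open>1 / t\<close> in probability, whatever the degree of
  vertex 1 (\<open>expectation_closes\<close>). From time 2 on, a step hence creates a triangle with conditional
  probability at least \<open>p / 2\<close>, and an exponential moment bound gives a linear lower bound
  (\<open>prob_few_triangles\<close>).

  Cherries. Their number is governed by the sum \<open>Q\<close> of the squared degrees (\<open>cherries_eq\<close>). The
  degree-biased law on the vertices, which governs preferential attachment, is stationary for the
  random walk on the graph, and a triad step is one step of this walk. So each of the \<open>m\<close> choices,
  although they are dependent, has the degree-biased law (\<open>expectation_choices_sum\<close>), as if \<open>p\<close> were 0.
  This gives \<open>E[Q' | G] = Q (1 + 1 / t) + r\<close> with \<open>r\<close> between \<open>m\<^sup>2 + m\<close> and \<open>2 m\<^sup>2\<close>, so that the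
  conditional mean of \<open>Q / t\<close> grows by about \<open>r / t\<close> per step and \<open>Q / t\<close> is of the order of the
  harmonic numbers. The remainder \<open>r\<close> depends on the graph through the repetitions among the
  choices, so the variance of \<open>Q / t\<close> itself need not be small.
  Instead, \<open>Q / t\<close> is compared with two deterministic curves, and the second moment of
  the overshoot above the upper and below the lower curve is bounded (\<open>E_positive_part\<close>). That moment
  grows by at most the conditional variance of each step, which the sum of the cubed degrees
  controls; its mean is \<open>O(t\<^sup>2)\<close> (\<open>E_degree_cube\<close>). The overshoot then has second moment
  \<open>O(ln t)\<close>, which is small against \<open>(ln t)\<^sup>2\<close>, so an overshoot of order \<open>ln t\<close> is unlikely.
\<close>

section \<open>Expectations under finitely supported laws\<close>

lemma expectation_bind_pmf_finite:
  fixes h :: "'b \<Rightarrow> real"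
  assumes "finite (set_pmf M)" "\<And>x. x \<in> set_pmf M \<Longrightarrow> finite (set_pmf (f x))"
  shows "measure_pmf.expectation (bind_pmf M f) h =
    measure_pmf.expectation M (\<lambda>x. measure_pmf.expectation (f x) h)"
  by (subst pmf_expectation_bind[OF assms(1) assms(2)])
    (auto simp: integral_measure_pmf[OF assms(1)])

lemma expectation_mono_finite:
  fixes f g :: "'a \<Rightarrow> real"
  assumes "finite (set_pmf M)" "\<And>x. x \<in> set_pmf M \<Longrightarrow> f x \<le> g x"
  shows "measure_pmf.expectation M f \<le> measure_pmf.expectation M g"
  by (rule integral_mono_AE)
    (use assms in \<open>auto intro: integrable_measure_pmf_finite simp: AE_measure_pmf_iff\<close>)

lemma expectation_cong:
  fixes f g :: "'a \<Rightarrow> real"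
  assumes "\<And>x. x \<in> set_pmf M \<Longrightarrow> f x = g x"
  shows "measure_pmf.expectation M f = measure_pmf.expectation M g"
  by (rule integral_cong_AE) (use assms in \<open>auto simp: AE_measure_pmf_iff\<close>)

text \<open>
  One step of a second moment bound for the overshoot of a process above a barrier: here \<open>x\<close> is the
  signed overshoot before the step and \<open>X\<close> the one after it. If the drift is not upward, only the
  variance of the step is added. The variance is at most the mean square deviation from any
  point \<open>c\<close>.
\<close>

lemma expectation_positive_part_square:
  fixes X :: "'a \<Rightarrow> real"
  assumes fin: "finite (set_pmf M)"
    and mean: "measure_pmf.expectation M X \<le> x"
    and var: "measure_pmf.expectation M (\<lambda>\<omega>. (X \<omega> - c)\<^sup>2) \<le> v"
  shows "measure_pmf.expectation M (\<lambda>\<omega>. (max 0 (X \<omega>))\<^sup>2) \<le> (max 0 x)\<^sup>2 + v"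
proof -
  note [simp] = integrable_measure_pmf_finite[OF fin]
  let ?E = "measure_pmf.expectation M"
  define \<mu> a b where "\<mu> = ?E X" and "a = max 0 x" and "b = a + c - \<mu>"
  \<comment> \<open>The right-hand side is the square of \<open>a + (X - \<mu>)\<close>, which dominates \<open>X\<close> because \<open>\<mu> \<le> a\<close>.\<close>
  have "(max 0 (X \<omega>))\<^sup>2 \<le> (X \<omega> - c + b)\<^sup>2" for \<omega>
  proof (cases "X \<omega> \<le> 0")
    case False
    then show ?thesis using mean unfolding b_def a_def \<mu>_def by (intro power_mono) auto
  qed simp
  then have "?E (\<lambda>\<omega>. (max 0 (X \<omega>))\<^sup>2) \<le> ?E (\<lambda>\<omega>. (X \<omega> - c + b)\<^sup>2)"
    by (intro expectation_mono_finite fin)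
  also have "\<dots> = ?E (\<lambda>\<omega>. (X \<omega> - c)\<^sup>2 + (2 * b * X \<omega> + (b\<^sup>2 - 2 * b * c)))"
    by (rule arg_cong[where f = ?E]) (auto simp: fun_eq_iff power2_eq_square algebra_simps)
  also have "\<dots> = ?E (\<lambda>\<omega>. (X \<omega> - c)\<^sup>2) + (2 * b * \<mu> + (b\<^sup>2 - 2 * b * c))"
    by (simp add: \<mu>_def)
  also have "2 * b * \<mu> + (b\<^sup>2 - 2 * b * c) = a\<^sup>2 - (\<mu> - c)\<^sup>2"
    by (simp add: b_def power2_eq_square algebra_simps)
  finally show ?thesis using var zero_le_power2[of "\<mu> - c"] unfolding a_def by linarith
qed

lemma sum_list_map_eq_sum_count_real:
  fixes f :: "'a \<Rightarrow> real"
  assumes "set xs \<subseteq> A" "finite A"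
  shows "sum_list (map f xs) = (\<Sum>x\<in>A. real (count_list xs x) * f x)"
  using assms(1)
proof (induction xs)
  case (Cons a xs)
  have "(\<Sum>x\<in>A. real (count_list (a # xs) x) * f x)
      = (\<Sum>x\<in>A. real (count_list xs x) * f x + (if a = x then f x else 0))"
    by (rule sum.cong) (auto simp: algebra_simps)
  also have "\<dots> = (\<Sum>x\<in>A. real (count_list xs x) * f x) + f a"
    using Cons.prems assms(2) by (simp add: sum.distrib)
  finally show ?case using Cons by simp
qed simp

lemma sum_list_square_le:
  fixes f :: "'a \<Rightarrow> real"
  shows "(sum_list (map f xs))\<^sup>2 \<le> real (length xs) * sum_list (map (\<lambda>x. (f x)\<^sup>2) xs)"
proof -
  have "(\<Sum>i<length xs. f (xs ! i))\<^sup>2 \<le> (\<Sum>i<length xs. (1::real)\<^sup>2) * (\<Sum>i<length xs. (f (xs ! i))\<^sup>2)"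
    using Cauchy_Schwarz_ineq_sum[of "\<lambda>_. 1::real" "\<lambda>i. f (xs ! i)" "{..<length xs}"] by simp
  then show ?thesis by (simp add: sum_list_sum_nth atLeast0LessThan)
qed

section \<open>The law of the choices in one step\<close>

definition degree_power_sum :: "nat \<Rightarrow> multigraph \<Rightarrow> real" where
  "degree_power_sum k G = (\<Sum>v\<in>verts G. real (vdegree G v) ^ k)"

locale hk_state =
  fixes m :: nat and p :: real and t :: nat and G :: multigraph
  assumes wf: "hk_wf m t G" and m1: "1 \<le> m" and t1: "1 \<le> t" and p0: "0 \<le> p" and p1: "p \<le> 1"
begin

abbreviation d :: "nat \<Rightarrow> real" where "d v \<equiv> real (vdegree G v)"
abbreviation V :: "nat set" where "V \<equiv> verts G"
abbreviation Q :: "nat \<Rightarrow> real" where "Q k \<equiv> degree_power_sum k G"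
abbreviation \<pi> :: "nat pmf" where "\<pi> \<equiv> pref_choice m t G"

lemma verts_eq: "V = {1..t}" using wf by (simp add: hk_wf_def)

lemma finite_verts: "finite V" by (simp add: verts_eq)

lemma new_notin: "Suc t \<notin> V" by (simp add: verts_eq)

lemma emult_sym: "emult G v w = emult G w v" using wf unfolding hk_wf_def by blast

lemma emult_outside: "v \<notin> V \<or> w \<notin> V \<Longrightarrow> emult G v w = 0"
  using wf unfolding hk_wf_def by metis

lemma degree_pos: "v \<in> V \<Longrightarrow> d v > 0"
proof -
  have "\<forall>v\<in>V. vdegree G v \<ge> 1" using wf unfolding hk_wf_def by blast
  then show "v \<in> V \<Longrightarrow> d v > 0" by fastforce
qed

lemma degree_sum: "(\<Sum>v\<in>V. d v) = 2 * real m * real t"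
proof -
  have "(\<Sum>v\<in>V. vdegree G v) = 2 * m * t" using wf unfolding hk_wf_def by blast
  then have "real (\<Sum>v\<in>V. vdegree G v) = real (2 * m * t)" by simp
  then show ?thesis by simp
qed

lemma degree_eq: "d v = (\<Sum>w\<in>V. real (emult G v w))"
  by (simp add: vdegree_eq_sum_verts[OF finite_verts])

lemma pmf_pi: "pmf \<pi> u = (if u \<in> V then d u / (2 * real m * real t) else 0)"
  using pmf_pref_choice[OF wf m1 t1, of u] by simp

lemma set_pi: "set_pmf \<pi> = V"
  using m1 t1 degree_pos by (force simp: set_pmf_iff pmf_pi split: if_splits)

lemma finite_set_pi: "finite (set_pmf \<pi>)" by (simp add: set_pi finite_verts)

lemma expectation_pi:
  "measure_pmf.expectation \<pi> f = (\<Sum>v\<in>V. d v * f v) / (2 * real m * real t)" for f :: "nat \<Rightarrow> real"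
  by (subst integral_measure_pmf_real[OF finite_verts])
    (auto simp: set_pi pmf_pi sum_divide_distrib intro!: sum.cong)

text \<open>
  Stationarity of the random walk: both a degree in the numerator and the one in the denominator
  of the transition probability belong to the same vertex and cancel, leaving the
  row sum of a symmetric matrix.
\<close>

lemma bind_pi_triad: "bind_pmf \<pi> (triad_choice G) = \<pi>"
proof (rule pmf_eqI)
  fix u
  have "pmf (bind_pmf \<pi> (triad_choice G)) u
      = (\<Sum>y\<in>V. d y * pmf (triad_choice G y) u) / (2 * real m * real t)"
    by (simp add: pmf_bind expectation_pi)
  also have "(\<Sum>y\<in>V. d y * pmf (triad_choice G y) u) = (\<Sum>y\<in>V. real (emult G u y))"
  proof (rule sum.cong)
    fix y assume y: "y \<in> V"
    then show "d y * pmf (triad_choice G y) u = real (emult G u y)"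
      using degree_pos[OF y] emult_outside[of u y] emult_sym[of u y]
      by (auto simp: pmf_triad_choice[OF wf y] neighbors_def)
  qed simp
  also have "\<dots> / (2 * real m * real t) = pmf \<pi> u"
    using emult_outside by (auto simp: pmf_pi degree_eq)
  finally show "pmf (bind_pmf \<pi> (triad_choice G)) u = pmf \<pi> u" .
qed

lemma bind_pi_next: "bind_pmf \<pi> (next_choice m p t G) = \<pi>"
proof -
  have "bind_pmf \<pi> (\<lambda>y. if \<xi> then triad_choice G y else \<pi>) = \<pi>" for \<xi>
    by (cases \<xi>) (simp_all add: bind_pi_triad)
  moreover have "bind_pmf \<pi> (next_choice m p t G) =
      bind_pmf (bernoulli_pmf p) (\<lambda>\<xi>. bind_pmf \<pi> (\<lambda>y. if \<xi> then triad_choice G y else \<pi>))"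
    unfolding next_choice_def by (rule bind_commute_pmf)
  ultimately show ?thesis by simp
qed

lemma finite_further: "y \<in> V \<Longrightarrow> finite (set_pmf (further_choices m p t G n y))"
proof -
  assume y: "y \<in> V"
  have "set_pmf (further_choices m p t G n y) \<subseteq> {ys. set ys \<subseteq> V \<and> length ys = n}"
    using set_further_choices[OF wf m1 t1 y] by blast
  then show ?thesis
    by (rule finite_subset) (rule finite_lists_length_eq[OF finite_verts])
qed

lemma finite_choices: "finite (set_pmf (choices m p t G))"
proof -
  have "set_pmf (choices m p t G) \<subseteq> {ys. set ys \<subseteq> V \<and> length ys = m}"
    using set_choices[OF wf m1 t1] by blast
  then show ?thesis
    by (rule finite_subset) (rule finite_lists_length_eq[OF finite_verts])
qed

text \<open>
  The first choice that follows a degree-biased one is again degree-biased, so it can be treated as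
  the start of the remaining chain.
\<close>

lemma further_choices_stationary:
  "bind_pmf \<pi> (further_choices m p t G (Suc n))
    = bind_pmf \<pi> (\<lambda>y. map_pmf ((#) y) (further_choices m p t G n y))"
proof -
  have "further_choices m p t G (Suc n) = (\<lambda>y. bind_pmf (next_choice m p t G y)
      (\<lambda>z. map_pmf ((#) z) (further_choices m p t G n z)))"
    by (simp add: fun_eq_iff map_pmf_def)
  then have "bind_pmf \<pi> (further_choices m p t G (Suc n))
      = bind_pmf (bind_pmf \<pi> (next_choice m p t G))
          (\<lambda>y. map_pmf ((#) y) (further_choices m p t G n y))"
    by (simp add: bind_assoc_pmf)
  then show ?thesis by (simp only: bind_pi_next)
qed

text \<open>
  The list of choices is a trajectory of the stationary chain; an unobserved choice can be put in
  front of it, which makes all entries arise from \<open>further_choices\<close>.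
\<close>

lemma choices_eq_further: "choices m p t G = bind_pmf \<pi> (further_choices m p t G m)"
  using further_choices_stationary[of "m - 1"] m1 by (simp add: choices_def map_pmf_def)

lemma expectation_further_sum:
  fixes f :: "nat \<Rightarrow> real"
  shows "measure_pmf.expectation (bind_pmf \<pi> (further_choices m p t G n)) (\<lambda>ys. sum_list (map f ys))
    = real n * measure_pmf.expectation \<pi> f"
proof (induction n)
  case (Suc n)
  note fin = finite_set_pi finite_further[folded set_pi]
  have "measure_pmf.expectation (bind_pmf \<pi> (further_choices m p t G (Suc n))) (\<lambda>ys. sum_list (map f ys))
      = measure_pmf.expectation \<pi> (\<lambda>y. measure_pmf.expectation (further_choices m p t G n y)
          (\<lambda>ys. f y + sum_list (map f ys)))"
    unfolding further_choices_stationary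
    by (subst expectation_bind_pmf_finite) (auto simp: fin)
  also have "\<dots> = measure_pmf.expectation \<pi> (\<lambda>y. f y + measure_pmf.expectation
      (further_choices m p t G n y) (\<lambda>ys. sum_list (map f ys)))"
    by (rule expectation_cong) (simp add: integrable_measure_pmf_finite fin)
  also have "\<dots> = measure_pmf.expectation \<pi> f + measure_pmf.expectation \<pi>
      (\<lambda>y. measure_pmf.expectation (further_choices m p t G n y) (\<lambda>ys. sum_list (map f ys)))"
    by (simp add: integrable_measure_pmf_finite fin)
  also have "\<dots> = measure_pmf.expectation \<pi> f + real n * measure_pmf.expectation \<pi> f"
    using Suc.IH by (subst (asm) expectation_bind_pmf_finite) (auto simp: fin)
  finally show ?case by (simp add: algebra_simps del: further_choices.simps)
qed (simp add: expectation_bind_pmf_finite finite_set_pi)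

lemma expectation_choices_sum:
  fixes f :: "nat \<Rightarrow> real"
  shows "measure_pmf.expectation (choices m p t G) (\<lambda>ys. sum_list (map f ys))
    = (\<Sum>v\<in>V. d v * f v) / (2 * real t)"
  using m1 by (simp add: choices_eq_further expectation_further_sum expectation_pi)

text \<open>
  The factor \<open>m\<close> from the number of choices cancels against the normalisation \<open>2 m t\<close> of the
  degree-biased law.
\<close>

lemma expectation_choices_degree_power:
  "measure_pmf.expectation (choices m p t G) (\<lambda>ys. sum_list (map (\<lambda>v. d v ^ k) ys))
    = Q (Suc k) / (2 * real t)"
  by (simp add: expectation_choices_sum degree_power_sum_def)

section \<open>The graph after one step\<close>

context
  fixes ys :: "nat list"
  assumes len: "length ys = m" and sub: "set ys \<subseteq> V"
begin

abbreviation H :: multigraph where "H \<equiv> add_vertex (Suc t) ys G"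
abbreviation c :: "nat \<Rightarrow> real" where "c v \<equiv> real (count_list ys v)"

lemma verts_H: "verts H = insert (Suc t) V" by (simp add: add_vertex_def)

lemma count_outside: "v \<notin> V \<Longrightarrow> count_list ys v = 0"
  using sub by (auto simp: count_list_0_iff)

lemma vdegree_H_sum: "vdegree H v = emult H v (Suc t) + (\<Sum>w\<in>V. emult H v w)"
  using vdegree_eq_sum_verts[of H v] finite_verts new_notin by (simp add: verts_H)

lemma vdegree_old: "v \<in> V \<Longrightarrow> vdegree H v = vdegree G v + count_list ys v"
proof -
  assume v: "v \<in> V"
  then have "v \<noteq> Suc t" using new_notin by auto
  moreover have "(\<Sum>w\<in>V. emult H v w) = (\<Sum>w\<in>V. emult G v w)"
    by (rule sum.cong) (use new_notin \<open>v \<noteq> Suc t\<close> in \<open>auto simp: add_vertex_def\<close>)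
  moreover have "emult H v (Suc t) = count_list ys v"
    using new_notin emult_outside[of v "Suc t"] \<open>v \<noteq> Suc t\<close> by (simp add: add_vertex_def)
  ultimately show ?thesis
    by (simp add: vdegree_H_sum vdegree_eq_sum_verts[OF finite_verts, of v])
qed

lemma vdegree_new: "vdegree H (Suc t) = m"
proof -
  have "(\<Sum>w\<in>V. emult H (Suc t) w) = (\<Sum>w\<in>V. count_list ys w)"
    by (rule sum.cong) (use new_notin emult_outside in \<open>auto simp: add_vertex_def\<close>)
  moreover have "emult H (Suc t) (Suc t) = 0"
    using new_notin count_outside emult_outside by (simp add: add_vertex_def)
  ultimately show ?thesis
    using sum_count_set[OF sub finite_verts] len by (simp add: vdegree_H_sum)
qed

lemma degree_power_sum_H:
  "degree_power_sum k H = real m ^ k + (\<Sum>v\<in>V. (d v + c v) ^ k)"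
proof -
  have "degree_power_sum k H = real m ^ k + (\<Sum>v\<in>V. real (vdegree H v) ^ k)"
    using finite_verts new_notin vdegree_new by (simp add: degree_power_sum_def verts_H)
  also have "(\<Sum>v\<in>V. real (vdegree H v) ^ k) = (\<Sum>v\<in>V. (d v + c v) ^ k)"
    by (rule sum.cong) (auto simp: vdegree_old)
  finally show ?thesis .
qed

lemma count_sum: "(\<Sum>v\<in>V. c v) = real m"
  using sum_count_set[OF sub finite_verts] len by (metis of_nat_sum)

lemma count_le: "c v \<le> real m"
  using count_le_length[of ys v] len by simp

lemma count_square_bounds: "real m \<le> (\<Sum>v\<in>V. (c v)\<^sup>2)" "(\<Sum>v\<in>V. (c v)\<^sup>2) \<le> (real m)\<^sup>2"
proof -
  have "c v \<le> (c v)\<^sup>2" for v by (cases "count_list ys v") (auto simp: power2_eq_square)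
  then have "(\<Sum>v\<in>V. c v) \<le> (\<Sum>v\<in>V. (c v)\<^sup>2)" by (intro sum_mono)
  then show "real m \<le> (\<Sum>v\<in>V. (c v)\<^sup>2)" by (simp add: count_sum)
  have "(\<Sum>v\<in>V. (c v)\<^sup>2) \<le> (\<Sum>v\<in>V. real m * c v)"
    by (intro sum_mono) (auto simp: power2_eq_square intro!: mult_right_mono count_le)
  then show "(\<Sum>v\<in>V. (c v)\<^sup>2) \<le> (real m)\<^sup>2"
    by (simp add: count_sum power2_eq_square flip: sum_distrib_left)
qed

lemma sum_list_eq: "sum_list (map f ys) = (\<Sum>v\<in>V. c v * f v)" for f :: "nat \<Rightarrow> real"
  by (rule sum_list_map_eq_sum_count_real[OF sub finite_verts])

text \<open>
  The last summand is the only source of randomness that the marginal laws of the choices do not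
  determine; \<open>count_square_bounds\<close> confines it to a bounded interval.
\<close>

lemma degree_square_sum_H:
  "degree_power_sum 2 H
    = Q 2 + 2 * sum_list (map d ys) + ((real m)\<^sup>2 + (\<Sum>v\<in>V. (c v)\<^sup>2))"
  unfolding degree_power_sum_H
  by (simp add: sum_list_eq degree_power_sum_def power2_sum sum.distrib sum_distrib_left
      algebra_simps)

lemma degree_cube_sum_H:
  "degree_power_sum 3 H
    \<le> Q 3 + 3 * sum_list (map (\<lambda>v. d v ^ 2) ys) + 3 * real m * sum_list (map d ys) + 2 * real m ^ 3"
proof -
  have "(d v + c v) ^ 3 \<le> d v ^ 3 + 3 * (c v * d v ^ 2) + 3 * real m * (c v * d v)
      + (real m)\<^sup>2 * c v" for v
  proof -
    have *: "(c v)\<^sup>2 \<le> real m * c v"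
      by (auto simp: power2_eq_square intro!: mult_right_mono count_le)
    have "c v ^ 3 = c v * (c v)\<^sup>2" by (simp add: power3_eq_cube power2_eq_square)
    also have "\<dots> \<le> real m * (real m * c v)" by (intro mult_mono * count_le) auto
    finally have "c v ^ 3 \<le> (real m)\<^sup>2 * c v" by (simp add: power2_eq_square)
    moreover have "(c v)\<^sup>2 * d v \<le> real m * c v * d v" by (intro mult_right_mono *) auto
    moreover have "(d v + c v) ^ 3
        = d v ^ 3 + 3 * (c v * d v ^ 2) + 3 * ((c v)\<^sup>2 * d v) + c v ^ 3"
      by (simp add: power3_eq_cube power2_eq_square algebra_simps)
    ultimately show ?thesis by simp
  qed
  then have "(\<Sum>v\<in>V. (d v + c v) ^ 3) \<le> (\<Sum>v\<in>V. d v ^ 3 + 3 * (c v * d v ^ 2)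
      + 3 * real m * (c v * d v) + (real m)\<^sup>2 * c v)"
    by (intro sum_mono)
  also have "\<dots> = Q 3 + 3 * sum_list (map (\<lambda>v. d v ^ 2) ys) + 3 * real m * sum_list (map d ys)
      + real m ^ 3"
    by (simp add: sum.distrib sum_list_eq degree_power_sum_def count_sum power2_eq_square
        power3_eq_cube flip: sum_distrib_left)
  finally show ?thesis by (simp add: degree_power_sum_H)
qed

lemma degree_square_increment:
  "(degree_power_sum 2 H - Q 2)\<^sup>2 \<le> 8 * real m ^ 4 + 8 * real m * sum_list (map (\<lambda>v. d v ^ 2) ys)"
proof -
  define x y where "x = sum_list (map d ys)" and "y = (real m)\<^sup>2 + (\<Sum>v\<in>V. (c v)\<^sup>2)"
  have y: "0 \<le> y" "y \<le> 2 * (real m)\<^sup>2"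
    using count_square_bounds by (auto simp: y_def sum_nonneg)
  have "(degree_power_sum 2 H - Q 2)\<^sup>2 = (2 * x + y)\<^sup>2"
    by (simp add: degree_square_sum_H x_def y_def)
  also have "\<dots> \<le> 8 * x\<^sup>2 + 2 * y\<^sup>2"
    using zero_le_power2[of "2 * x - y"] by (simp add: power2_eq_square algebra_simps)
  finally have "(degree_power_sum 2 H - Q 2)\<^sup>2 \<le> 8 * x\<^sup>2 + 2 * y\<^sup>2" .
  moreover have "y\<^sup>2 \<le> (2 * (real m)\<^sup>2)\<^sup>2" by (rule power_mono[OF y(2,1)])
  moreover have "x\<^sup>2 \<le> real m * sum_list (map (\<lambda>v. d v ^ 2) ys)"
    using sum_list_square_le[of d ys] len by (simp add: x_def)
  ultimately show ?thesis by (simp add: power_mult_distrib)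
qed

lemma emult_H_old: "v \<in> V \<Longrightarrow> w \<in> V \<Longrightarrow> emult H v w = emult G v w"
  using new_notin by (auto simp: add_vertex_def)

lemma neighbors_H_new: "v \<noteq> Suc t \<Longrightarrow> v \<in> neighbors H (Suc t) \<longleftrightarrow> v \<in> set ys"
  using emult_outside[of "Suc t" v] new_notin sub count_list_0_iff[of ys v]
  by (auto simp: neighbors_def add_vertex_def)

lemma neighbors_H_sym: "v \<in> verts H \<Longrightarrow> w \<in> neighbors H v \<Longrightarrow> v \<in> neighbors H w"
  using emult_sym[of v w] by (auto simp: neighbors_def add_vertex_def)

lemma neighbors_H_old: "v \<in> V \<Longrightarrow> w \<in> V \<Longrightarrow> w \<in> neighbors H v \<longleftrightarrow> w \<in> neighbors G v"
  by (simp add: neighbors_def emult_H_old verts_H)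

lemma triangles_H_old: "T \<subseteq> V \<Longrightarrow> T \<in> triangles H \<longleftrightarrow> T \<in> triangles G"
  using neighbors_H_old by (auto simp: triangles_def verts_H subset_iff)

lemma finite_triangles_H: "finite (triangles H)"
  by (rule finite_subset[of _ "Pow (verts H)"])
    (auto simp: triangles_def verts_H finite_verts)

lemma triangles_mono: "triangles G \<subseteq> triangles H"
proof
  fix T assume T: "T \<in> triangles G"
  then have "T \<subseteq> V" by (simp add: triangles_def)
  with T show "T \<in> triangles H" by (simp add: triangles_H_old)
qed

lemma card_triangles_H_le: "card (triangles H) \<le> card (triangles G) + m\<^sup>2"
proof -
  let ?N = "(\<lambda>(a, b). {Suc t, a, b}) ` (set ys \<times> set ys)"
  have "triangles H \<subseteq> triangles G \<union> ?N"
  proof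
    fix T assume T: "T \<in> triangles H"
    show "T \<in> triangles G \<union> ?N"
    proof (cases "Suc t \<in> T")
      case False
      with T have "T \<subseteq> V" by (auto simp: triangles_def verts_H)
      with T show ?thesis by (simp add: triangles_H_old)
    next
      case True
      with T have "card (T - {Suc t}) = 2" by (simp add: triangles_def)
      then obtain a b where ab: "T - {Suc t} = {a, b}" by (auto simp: card_2_iff)
      then have T_eq: "T = {Suc t, a, b}" and "a \<noteq> Suc t" "b \<noteq> Suc t" using True by auto
      moreover have "a \<in> neighbors H (Suc t)" "b \<in> neighbors H (Suc t)"
        using T T_eq \<open>a \<noteq> Suc t\<close> \<open>b \<noteq> Suc t\<close> by (auto simp: triangles_def)
      ultimately show ?thesis by (auto simp: neighbors_H_new)
    qed
  qed
  moreover have fin: "finite (triangles G \<union> ?N)"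
    using finite_subset[OF triangles_mono finite_triangles_H] by simp
  ultimately have "card (triangles H) \<le> card (triangles G \<union> ?N)" by (rule card_mono[rotated])
  also have "\<dots> \<le> card (triangles G) + card ?N" by (rule card_Un_le)
  also have "card ?N \<le> card (set ys \<times> set ys)" by (rule card_image_le) simp
  also have "\<dots> \<le> m * m" using card_length[of ys] len by (simp add: card_cartesian_product mult_mono)
  finally show ?thesis by (simp add: power2_eq_square)
qed

lemma card_triangles_H_ge: "card (triangles G) \<le> card (triangles H)"
  by (rule card_mono[OF finite_triangles_H triangles_mono])

lemma card_triangles_H_closed:
  assumes "ys = a # b # zs" "a \<noteq> b" "b \<in> neighbors G a"
  shows "Suc (card (triangles G)) \<le> card (triangles H)"
proof -
  let ?T = "{Suc t, a, b}"
  have "a \<in> set ys" "b \<in> set ys" using assms(1) by simp_all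
  then have V: "a \<in> V" "b \<in> V" using sub by auto
  then have ne: "a \<noteq> Suc t" "b \<noteq> Suc t" using new_notin by auto
  have "a \<in> neighbors H (Suc t)" "b \<in> neighbors H (Suc t)"
    using ne \<open>a \<in> set ys\<close> \<open>b \<in> set ys\<close> by (simp_all add: neighbors_H_new)
  moreover have "b \<in> neighbors H a" using V assms(3) by (simp add: neighbors_H_old)
  ultimately have "?T \<in> triangles H"
    using V ne assms(2) neighbors_H_sym by (auto simp: triangles_def verts_H)
  then have "insert ?T (triangles G) \<subseteq> triangles H" using triangles_mono by simp
  moreover have "?T \<notin> triangles G" using new_notin by (auto simp: triangles_def)
  ultimately show ?thesis
    using card_mono[OF finite_triangles_H, of "insert ?T (triangles G)"]
      finite_subset[OF triangles_mono finite_triangles_H] by simp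
qed

lemma loops_H: "(\<Sum>v\<in>verts H. emult H v v) = (\<Sum>v\<in>V. emult G v v)"
proof -
  have "emult H (Suc t) (Suc t) = 0"
    using new_notin count_outside emult_outside by (simp add: add_vertex_def)
  then show ?thesis
    using finite_verts new_notin by (simp add: verts_H emult_H_old)
qed

end

section \<open>Conditional moments of one step\<close>

text \<open>
  A crude bound that ignores the typical order \<open>t ln t\<close>, but suffices for the growth of the sum of
  the cubed degrees.
\<close>

lemma degree_square_sum_le: "Q 2 \<le> 4 * (real m)\<^sup>2 * (real t)\<^sup>2"
proof -
  have "d v \<le> 2 * real m * real t" if "v \<in> V" for v
    using member_le_sum[of v V d] that finite_verts by (simp add: degree_sum)
  then have "Q 2 \<le> (\<Sum>v\<in>V. (2 * real m * real t) * d v)"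
    unfolding degree_power_sum_def by (intro sum_mono) (auto simp: power2_eq_square intro!: mult_right_mono)
  also have "\<dots> = 4 * (real m)\<^sup>2 * (real t)\<^sup>2"
    by (simp add: degree_sum power2_eq_square flip: sum_distrib_left)
  finally show ?thesis .
qed

lemma expectation_step:
  fixes F :: "multigraph \<Rightarrow> real"
  shows "measure_pmf.expectation (hk_step m p t G) F
    = measure_pmf.expectation (choices m p t G) (\<lambda>ys. F (add_vertex (Suc t) ys G))"
  by (simp add: hk_step_def)

lemma finite_step: "finite (set_pmf (hk_step m p t G))"
  by (simp add: hk_step_def finite_choices)

text \<open>
  Each of the \<open>m\<close> choices adds on average twice the degree-biased mean degree, together \<open>Q 2 / t\<close>.
  The remaining terms come from the degree of the new vertex and from the squared
  multiplicities of the new edges.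
\<close>

lemma expectation_step_degree_square:
  "Q 2 * (1 + 1 / real t) + ((real m)\<^sup>2 + real m)
      \<le> measure_pmf.expectation (hk_step m p t G) (degree_power_sum 2)"
  "measure_pmf.expectation (hk_step m p t G) (degree_power_sum 2)
      \<le> Q 2 * (1 + 1 / real t) + 2 * (real m)\<^sup>2"
proof -
  let ?E = "measure_pmf.expectation (choices m p t G)"
  note int = integrable_measure_pmf_finite[OF finite_choices]
  note ch = set_choices[OF wf m1 t1]
  have lin: "?E (\<lambda>ys. Q 2 + 2 * sum_list (map d ys) + r) = Q 2 * (1 + 1 / real t) + r" for r
    using t1 expectation_choices_degree_power[of 1]
    by (simp add: int numeral_2_eq_2 field_simps)
  have "?E (\<lambda>ys. Q 2 + 2 * sum_list (map d ys) + ((real m)\<^sup>2 + real m))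
      \<le> ?E (\<lambda>ys. degree_power_sum 2 (add_vertex (Suc t) ys G))"
    by (rule expectation_mono_finite[OF finite_choices])
      (use ch count_square_bounds in \<open>auto simp: degree_square_sum_H\<close>)
  then show "Q 2 * (1 + 1 / real t) + ((real m)\<^sup>2 + real m)
      \<le> measure_pmf.expectation (hk_step m p t G) (degree_power_sum 2)"
    unfolding lin expectation_step .
  have "?E (\<lambda>ys. degree_power_sum 2 (add_vertex (Suc t) ys G))
      \<le> ?E (\<lambda>ys. Q 2 + 2 * sum_list (map d ys) + 2 * (real m)\<^sup>2)"
    by (rule expectation_mono_finite[OF finite_choices])
      (use ch count_square_bounds in \<open>force simp: degree_square_sum_H\<close>)
  then show "measure_pmf.expectation (hk_step m p t G) (degree_power_sum 2)
      \<le> Q 2 * (1 + 1 / real t) + 2 * (real m)\<^sup>2"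
    unfolding lin expectation_step .
qed

lemma expectation_step_degree_cube:
  "measure_pmf.expectation (hk_step m p t G) (degree_power_sum 3)
    \<le> Q 3 * (1 + 3 / (2 * real t)) + 6 * real m ^ 3 * real t + 2 * real m ^ 3"
proof -
  let ?E = "measure_pmf.expectation (choices m p t G)"
  note int = integrable_measure_pmf_finite[OF finite_choices]
  have "measure_pmf.expectation (hk_step m p t G) (degree_power_sum 3)
      \<le> ?E (\<lambda>ys. Q 3 + 3 * sum_list (map (\<lambda>v. d v ^ 2) ys) + 3 * real m * sum_list (map d ys)
          + 2 * real m ^ 3)"
    unfolding expectation_step
    by (rule expectation_mono_finite[OF finite_choices])
      (use set_choices[OF wf m1 t1] degree_cube_sum_H in auto)
  also have "\<dots> = Q 3 + 3 * (Q 3 / (2 * real t)) + 3 * real m * (Q 2 / (2 * real t)) + 2 * real m ^ 3"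
    using expectation_choices_degree_power[of 1] expectation_choices_degree_power[of 2]
    by (simp add: int numeral_2_eq_2 numeral_3_eq_3)
  also have "3 * real m * (Q 2 / (2 * real t)) \<le> 3 * real m * (4 * (real m)\<^sup>2 * (real t)\<^sup>2 / (2 * real t))"
    by (intro mult_left_mono divide_right_mono degree_square_sum_le) auto
  also have "\<dots> = 6 * real m ^ 3 * real t"
    using t1 by (simp add: power2_eq_square power3_eq_cube)
  finally show ?thesis by (simp add: algebra_simps)
qed

lemma expectation_step_degree_square_variance:
  "measure_pmf.expectation (hk_step m p t G) (\<lambda>H. (degree_power_sum 2 H - Q 2)\<^sup>2)
    \<le> 8 * real m ^ 4 + 4 * real m * Q 3 / real t"
proof -
  let ?E = "measure_pmf.expectation (choices m p t G)"
  note int = integrable_measure_pmf_finite[OF finite_choices]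
  have "measure_pmf.expectation (hk_step m p t G) (\<lambda>H. (degree_power_sum 2 H - Q 2)\<^sup>2)
      \<le> ?E (\<lambda>ys. 8 * real m ^ 4 + 8 * real m * sum_list (map (\<lambda>v. d v ^ 2) ys))"
    unfolding expectation_step
    by (rule expectation_mono_finite[OF finite_choices])
      (use set_choices[OF wf m1 t1] degree_square_increment in auto)
  also have "\<dots> = 8 * real m ^ 4 + 4 * real m * Q 3 / real t"
    using expectation_choices_degree_power[of 2]
    by (simp add: int numeral_3_eq_3)
  finally show ?thesis .
qed

text \<open>
  Only the triangle spanned by the new vertex and its first two choices is counted: one such triangle
  per step already gives the right order.
\<close>

definition closes :: "nat list \<Rightarrow> bool" where
  "closes ys \<longleftrightarrow> (\<exists>a b zs. ys = a # b # zs \<and> a \<noteq> b \<and> b \<in> neighbors G a)"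

lemma expectation_triad_distinct:
  assumes y: "y \<in> V"
  shows "measure_pmf.expectation (triad_choice G y) (\<lambda>z. of_bool (y \<noteq> z \<and> z \<in> neighbors G y))
    = 1 - real (emult G y y) / d y"
proof -
  have sub: "z \<in> V" if "z \<in> set_pmf (triad_choice G y)" for z
    using that by (auto simp: set_pmf_iff pmf_triad_choice[OF wf y] neighbors_def split: if_splits)
  have "measure_pmf.expectation (triad_choice G y) (\<lambda>z. of_bool (y \<noteq> z \<and> z \<in> neighbors G y))
      = (\<Sum>z\<in>V. of_bool (y \<noteq> z \<and> z \<in> neighbors G y) * pmf (triad_choice G y) z)"
    by (rule integral_measure_pmf_real[OF finite_verts]) (rule sub)
  also have "\<dots> = (\<Sum>z\<in>V. real (emult G y z) / d y - (if z = y then real (emult G y y) / d y else 0))"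
    by (rule sum.cong) (auto simp: pmf_triad_choice[OF wf y] neighbors_def)
  also have "\<dots> = d y / d y - real (emult G y y) / d y"
    using y finite_verts by (simp add: sum_subtractf degree_eq[of y] flip: sum_divide_distrib)
  finally show ?thesis using degree_pos[OF y] by simp
qed

text \<open>
  Averaged over the degree-biased first choice \<open>y\<close>, the probability \<open>emult G y y / d y\<close> that a triad
  step stays at \<open>y\<close> becomes the total number of loop ends, divided by the total degree. In the
  model that number is always \<open>2 * m\<close>. The second choice exists as \<open>m \<ge> 2\<close>, and it is a
  triad step with probability \<open>p\<close>.
\<close>

lemma expectation_closes:
  assumes loops: "(\<Sum>v\<in>V. emult G v v) = 2 * m" and m2: "2 \<le> m"
  shows "p * (1 - 1 / real t) \<le> measure_pmf.expectation (choices m p t G) (\<lambda>ys. of_bool (closes ys))"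
proof -
  define j :: "nat \<Rightarrow> nat \<Rightarrow> real" where "j y z = of_bool (y \<noteq> z \<and> z \<in> neighbors G y)" for y z
  obtain k where k: "m - 1 = Suc k" using m2 by (cases "m - 1") auto
  have fin_next: "finite (set_pmf (next_choice m p t G y))" if "y \<in> V" for y
    using set_next_choice[OF wf m1 t1 that] finite_verts by (rule finite_subset)
  have next_V: "z \<in> V" if "y \<in> V" "z \<in> set_pmf (next_choice m p t G y)" for y z
    using set_next_choice[OF wf m1 t1 that(1)] that(2) by blast
  have "measure_pmf.expectation (choices m p t G) (\<lambda>ys. of_bool (closes ys) :: real)
      = measure_pmf.expectation \<pi> (\<lambda>y. measure_pmf.expectation (further_choices m p t G (Suc k) y)
          (\<lambda>zs. of_bool (closes (y # zs))))"
    unfolding choices_def k map_pmf_def[symmetric]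
    by (subst expectation_bind_pmf_finite)
      (auto simp: finite_set_pi finite_further set_pi finite_verts simp del: further_choices.simps)
  also have "\<dots> = measure_pmf.expectation \<pi>
      (\<lambda>y. measure_pmf.expectation (next_choice m p t G y) (j y))"
  proof (rule expectation_cong)
    fix y assume "y \<in> set_pmf \<pi>"
    then have y: "y \<in> V" by (simp add: set_pi)
    have "closes (y # z # zs) \<longleftrightarrow> y \<noteq> z \<and> z \<in> neighbors G y" for z zs
      by (auto simp: closes_def)
    then show "measure_pmf.expectation (further_choices m p t G (Suc k) y)
        (\<lambda>zs. of_bool (closes (y # zs))) = measure_pmf.expectation (next_choice m p t G y) (j y)"
      unfolding further_choices.simps map_pmf_def[symmetric]
      by (subst expectation_bind_pmf_finite)
        (auto simp: fin_next[OF y] next_V[OF y] finite_further j_def [abs_def])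
  qed
  \<comment> \<open>The preferential attachment case of the second choice is discarded.\<close>
  also have "\<dots> \<ge> measure_pmf.expectation \<pi> (\<lambda>y. p * (1 - real (emult G y y) / d y))"
  proof (rule expectation_mono_finite[OF finite_set_pi])
    fix y assume "y \<in> set_pmf \<pi>"
    then have y: "y \<in> V" by (simp add: set_pi)
    have fin_triad: "finite (set_pmf (triad_choice G y))"
      by (rule finite_subset[OF _ finite_verts])
        (auto simp: set_pmf_iff pmf_triad_choice[OF wf y] neighbors_def split: if_splits)
    have "measure_pmf.expectation (next_choice m p t G y) (j y)
        = measure_pmf.expectation (triad_choice G y) (j y) * p
          + measure_pmf.expectation \<pi> (j y) * (1 - p)"
      unfolding next_choice_def
      by (subst expectation_bind_pmf_finite)
        (use p0 p1 fin_triad finite_set_pi in \<open>auto simp: finite_subset[OF subset_UNIV]\<close>)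
    moreover have "0 \<le> measure_pmf.expectation \<pi> (j y) * (1 - p)"
      using p1 by (intro mult_nonneg_nonneg integral_nonneg) (auto simp: j_def)
    moreover have "measure_pmf.expectation (triad_choice G y) (j y) = 1 - real (emult G y y) / d y"
      unfolding j_def by (rule expectation_triad_distinct[OF y])
    ultimately show "p * (1 - real (emult G y y) / d y)
        \<le> measure_pmf.expectation (next_choice m p t G y) (j y)" by (simp add: mult.commute)
  qed
  also have "measure_pmf.expectation \<pi> (\<lambda>y. p * (1 - real (emult G y y) / d y))
      = p * ((\<Sum>y\<in>V. d y - real (emult G y y)) / (2 * real m * real t))"
  proof -
    have "(\<Sum>y\<in>V. d y * (1 - real (emult G y y) / d y)) = (\<Sum>y\<in>V. d y - real (emult G y y))"
      by (rule sum.cong) (use degree_pos in \<open>auto simp: field_simps\<close>)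
    then show ?thesis by (simp add: expectation_pi)
  qed
  also have "(\<Sum>y\<in>V. d y - real (emult G y y)) = 2 * real m * real t - 2 * real m"
  proof -
    have "real (\<Sum>v\<in>V. emult G v v) = real (2 * m)" using loops by (rule arg_cong)
    then show ?thesis by (simp add: sum_subtractf degree_sum)
  qed
  also have "(2 * real m * real t - 2 * real m) / (2 * real m * real t) = 1 - 1 / real t"
    using m1 t1 by (simp add: field_simps)
  finally show ?thesis .
qed

text \<open>
  The exponential moment \<open>2 ^ (- \<Delta>)\<close> is at least halved whenever a triangle is closed, which happens with
  probability at least \<open>p / 2\<close> since \<open>1 - 1 / t \<ge> 1 / 2\<close>.
\<close>

lemma expectation_step_triangles:
  assumes "(\<Sum>v\<in>V. emult G v v) = 2 * m" "2 \<le> m" "2 \<le> t"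
  shows "measure_pmf.expectation (hk_step m p t G) (\<lambda>H. (1 / 2) ^ card (triangles H))
    \<le> (1 / 2 :: real) ^ card (triangles G) * (1 - p / 4)"
proof -
  let ?E = "measure_pmf.expectation (choices m p t G)"
  note int = integrable_measure_pmf_finite[OF finite_choices]
  let ?h = "(1 / 2 :: real) ^ card (triangles G)"
  have "measure_pmf.expectation (hk_step m p t G) (\<lambda>H. (1 / 2) ^ card (triangles H))
      \<le> ?E (\<lambda>ys. ?h * (1 - of_bool (closes ys) / 2))"
    unfolding expectation_step
  proof (rule expectation_mono_finite[OF finite_choices])
    fix ys assume "ys \<in> set_pmf (choices m p t G)"
    then have ys: "length ys = m" "set ys \<subseteq> V" using set_choices[OF wf m1 t1] by auto
    show "(1 / 2) ^ card (triangles (add_vertex (Suc t) ys G)) \<le> ?h * (1 - of_bool (closes ys) / 2)"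
    proof (cases "closes ys")
      case True
      then obtain a b zs where "ys = a # b # zs" "a \<noteq> b" "b \<in> neighbors G a"
        by (auto simp: closes_def)
      from power_decreasing[OF card_triangles_H_closed[OF ys this], of "1 / 2 :: real"] True
      show ?thesis by simp
    next
      case False
      with power_decreasing[OF card_triangles_H_ge[OF ys], of "1 / 2 :: real"] show ?thesis by simp
    qed
  qed
  also have "\<dots> = ?h * (1 - ?E (\<lambda>ys. of_bool (closes ys)) / 2)"
    by (simp add: int)
  also have "\<dots> \<le> ?h * (1 - p / 4)"
  proof (rule mult_left_mono)
    have "p * (1 / 2) \<le> p * (1 - 1 / real t)"
      using assms(3) p0 by (intro mult_left_mono) (auto simp: field_simps)
    then show "1 - ?E (\<lambda>ys. of_bool (closes ys)) / 2 \<le> 1 - p / 4"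
      using expectation_closes[OF assms(1,2)] by linarith
  qed simp
  finally show ?thesis .
qed

end

section \<open>The process\<close>

lemma vdegree_initial: "vdegree (initial_graph m) 1 = 2 * m"
  by (subst vdegree_eq_sum_verts) (simp_all add: initial_graph_def)

lemma degree_power_sum_initial: "degree_power_sum k (initial_graph m) = (2 * real m) ^ k"
proof -
  have "verts (initial_graph m) = {1}" by (simp add: initial_graph_def)
  then show ?thesis using vdegree_initial[of m] by (simp add: degree_power_sum_def)
qed

lemma triangles_initial: "triangles (initial_graph m) = {}"
proof -
  have "card T \<noteq> 3" if "T \<subseteq> {1}" for T :: "nat set"
    using card_mono[OF _ that] by simp
  then show ?thesis by (auto simp: triangles_def initial_graph_def)
qed

locale hk_process =
  fixes m :: nat and p :: real
  assumes m2: "2 \<le> m" and p0: "0 \<le> p" and p1: "p \<le> 1"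
begin

abbreviation E :: "nat \<Rightarrow> (multigraph \<Rightarrow> real) \<Rightarrow> real" where
  "E t F \<equiv> measure_pmf.expectation (hk_graph m p t) F"

lemma state: "t \<ge> 1 \<Longrightarrow> G \<in> set_pmf (hk_graph m p t) \<Longrightarrow> hk_state m p t G"
  using hk_graph_wf[of m t G p] m2 p0 p1 by (simp add: hk_state_def)

lemma hk_graph_Suc: "t \<ge> 1 \<Longrightarrow> hk_graph m p (Suc t) = bind_pmf (hk_graph m p t) (hk_step m p t)"
  by (cases t) auto

lemma finite_hk_graph: "t \<ge> 1 \<Longrightarrow> finite (set_pmf (hk_graph m p t))"
proof (induction t rule: nat_induct_at_least)
  case (Suc t)
  then show ?case using hk_state.finite_step[OF state] by (simp add: hk_graph_Suc)
qed (simp add: One_nat_def)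

lemma E_Suc_le:
  assumes "t \<ge> 1" and step: "\<And>G. G \<in> set_pmf (hk_graph m p t) \<Longrightarrow>
    measure_pmf.expectation (hk_step m p t G) F \<le> F' G"
  shows "E (Suc t) F \<le> E t F'"
proof -
  have "E (Suc t) F = E t (\<lambda>G. measure_pmf.expectation (hk_step m p t G) F)"
    unfolding hk_graph_Suc[OF assms(1)]
    by (rule expectation_bind_pmf_finite)
      (use assms(1) finite_hk_graph hk_state.finite_step[OF state] in auto)
  also have "\<dots> \<le> E t F'"
    by (rule expectation_mono_finite) (use assms finite_hk_graph in auto)
  finally show ?thesis .
qed

lemma support_induct [consumes 2, case_names initial step]:
  assumes "t \<ge> 1" "G \<in> set_pmf (hk_graph m p t)"
    and "P 1 (initial_graph m)"
    and "\<And>t G ys. t \<ge> 1 \<Longrightarrow> hk_state m p t G \<Longrightarrow> length ys = m \<Longrightarrow> set ys \<subseteq> verts G \<Longrightarrow> P t G \<Longrightarrow>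
      P (Suc t) (add_vertex (Suc t) ys G)"
  shows "P t G"
  using assms(1,2)
proof (induction t arbitrary: G rule: nat_induct_at_least)
  case base
  then show ?case using assms(3) by simp
next
  case (Suc t)
  then obtain G' ys where G': "G' \<in> set_pmf (hk_graph m p t)"
    and ys: "ys \<in> set_pmf (choices m p t G')" and G: "G = add_vertex (Suc t) ys G'"
    by (auto simp: hk_graph_Suc hk_step_def)
  interpret hk_state m p t G' by (rule state[OF Suc.hyps G'])
  show ?case
    unfolding G using set_choices[OF wf m1 t1 ys] Suc.hyps hk_state_axioms Suc.IH[OF G']
    by (intro assms(4)) auto
qed

text \<open>
  A new vertex never chooses itself, so the initial loops are the only ones.
\<close>

lemma loops:
  assumes "t \<ge> 1" "G \<in> set_pmf (hk_graph m p t)"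
  shows "(\<Sum>v\<in>verts G. emult G v v) = 2 * m"
  using assms
proof (induction rule: support_induct)
  case initial
  show ?case by (simp add: initial_graph_def)
next
  case (step t G ys)
  then show ?case by (simp add: hk_state.loops_H)
qed

lemma card_triangles_le:
  assumes "t \<ge> 1" "G \<in> set_pmf (hk_graph m p t)"
  shows "card (triangles G) \<le> m\<^sup>2 * t"
  using assms
proof (induction rule: support_induct)
  case initial
  show ?case by (simp add: triangles_initial)
next
  case (step t G ys)
  then show ?case using hk_state.card_triangles_H_le[of m p t G ys] by simp
qed

text \<open>
  The true order is \<open>t\<close> to the power \<open>3 / 2\<close>. A quadratic bound is enough, because it makes the step
  variance of \<open>Q / t\<close> of order \<open>1 / t\<close>, and it survives the recursion: with the factor 12 the
  terms of order \<open>t\<close> on both sides are equal.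
\<close>

lemma E_degree_cube: "t \<ge> 1 \<Longrightarrow> E t (degree_power_sum 3) \<le> 12 * real m ^ 3 * (real t)\<^sup>2"
proof (induction t rule: nat_induct_at_least)
  case base
  show ?case by (simp add: degree_power_sum_initial power_mult_distrib)
next
  case (Suc t)
  note fin = finite_hk_graph[OF Suc.hyps]
  note [simp] = integrable_measure_pmf_finite[OF fin]
  have "E (Suc t) (degree_power_sum 3)
      \<le> E t (\<lambda>G. degree_power_sum 3 G * (1 + 3 / (2 * real t)) + 6 * real m ^ 3 * real t + 2 * real m ^ 3)"
    by (rule E_Suc_le[OF Suc.hyps]) (rule hk_state.expectation_step_degree_cube[OF state[OF Suc.hyps]])
  also have "\<dots> = E t (degree_power_sum 3) * (1 + 3 / (2 * real t))
      + 6 * real m ^ 3 * real t + 2 * real m ^ 3"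
    by simp
  also have "\<dots> \<le> 12 * real m ^ 3 * (real t)\<^sup>2 * (1 + 3 / (2 * real t))
      + 6 * real m ^ 3 * real t + 2 * real m ^ 3"
    by (intro add_mono mult_right_mono Suc.IH) auto
  also have "\<dots> = real m ^ 3 * (12 * (real t)\<^sup>2 + 24 * real t + 2)"
    using Suc.hyps by (simp add: power2_eq_square field_simps)
  also have "\<dots> \<le> real m ^ 3 * (12 * (real (Suc t))\<^sup>2)"
    by (intro mult_left_mono) (auto simp: power2_eq_square algebra_simps)
  finally show ?case by (simp add: mult.assoc mult.left_commute)
qed

section \<open>Concentration of the sum of squared degrees\<close>

text \<open>
  The sign \<open>s\<close> selects the side: \<open>s = 1\<close> with \<open>b = - (upper curve)\<close> measures the overshoot of
  \<open>Q / t\<close> above a curve, and \<open>s = - 1\<close> with \<open>b = lower curve\<close> the shortfall below one. The assumptions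
  say that the process starts on the right side and that the curve moves at least as fast as the
  conditional mean.
\<close>

lemma E_positive_part:
  fixes s :: real and b :: "nat \<Rightarrow> real"
  defines "X \<equiv> \<lambda>t G. s * (degree_power_sum 2 G / real t) + b t"
  assumes s: "s\<^sup>2 = 1"
    and start: "4 * s * (real m)\<^sup>2 + b 1 \<le> 0"
    and drift: "\<And>t G. t \<ge> 1 \<Longrightarrow> G \<in> set_pmf (hk_graph m p t) \<Longrightarrow>
      measure_pmf.expectation (hk_step m p t G) (X (Suc t)) \<le> X t G"
    and t: "t \<ge> 1"
  shows "E t (\<lambda>G. (max 0 (X t G))\<^sup>2) \<le> 56 * real m ^ 4 * harm t"
  using t
proof (induction t rule: nat_induct_at_least)
  case base
  have "X 1 (initial_graph m) \<le> 0"
    using start by (simp add: X_def degree_power_sum_initial power_mult_distrib mult.left_commute)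
  then show ?case by (simp add: harm_def max_def)
next
  case (Suc t)
  note fin = finite_hk_graph[OF Suc.hyps]
  note [simp] = integrable_measure_pmf_finite[OF fin]
  let ?v = "\<lambda>G. (8 * real m ^ 4 + 4 * real m * degree_power_sum 3 G / real t) / (real (Suc t))\<^sup>2"
  have "E (Suc t) (\<lambda>G. (max 0 (X (Suc t) G))\<^sup>2) \<le> E t (\<lambda>G. (max 0 (X t G))\<^sup>2 + ?v G)"
  proof (rule E_Suc_le[OF Suc.hyps])
    fix G assume G: "G \<in> set_pmf (hk_graph m p t)"
    interpret hk_state m p t G by (rule state[OF Suc.hyps G])
    \<comment> \<open>Centring at \<open>?c\<close>, which is \<open>X (Suc t)\<close> with the old degrees, reduces the deviation to
      the increment of the sum of squares.\<close>
    let ?c = "s * (degree_power_sum 2 G / real (Suc t)) + b (Suc t)"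
    have eq: "(X (Suc t) H - ?c)\<^sup>2
        = (degree_power_sum 2 H - degree_power_sum 2 G)\<^sup>2 / (real (Suc t))\<^sup>2" for H
    proof -
      have "X (Suc t) H - ?c = s * ((degree_power_sum 2 H - degree_power_sum 2 G) / real (Suc t))"
        by (simp add: X_def right_diff_distrib diff_divide_distrib)
      then show ?thesis by (simp add: power_mult_distrib power_divide s del: of_nat_Suc)
    qed
    have "measure_pmf.expectation (hk_step m p t G) (\<lambda>H. (X (Suc t) H - ?c)\<^sup>2) \<le> ?v G"
      unfolding eq using expectation_step_degree_square_variance
      by (simp add: divide_right_mono del: of_nat_Suc)
    then show "measure_pmf.expectation (hk_step m p t G) (\<lambda>H. (max 0 (X (Suc t) H))\<^sup>2)
        \<le> (max 0 (X t G))\<^sup>2 + ?v G"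
      by (rule expectation_positive_part_square[OF finite_step drift[OF Suc.hyps G]])
  qed
  also have "\<dots> = E t (\<lambda>G. (max 0 (X t G))\<^sup>2)
      + (8 * real m ^ 4 + 4 * real m * E t (degree_power_sum 3) / real t) / (real (Suc t))\<^sup>2"
    by (simp add: mult.assoc del: of_nat_Suc)
  also have "\<dots> \<le> 56 * real m ^ 4 * harm t + 56 * real m ^ 4 / real (Suc t)"
  proof (rule add_mono[OF Suc.IH])
    have "4 * real m * E t (degree_power_sum 3) / real t
        \<le> 4 * real m * (12 * real m ^ 3 * (real t)\<^sup>2) / real t"
      by (intro divide_right_mono mult_left_mono E_degree_cube Suc.hyps) auto
    also have "\<dots> = 48 * real m ^ 4 * real t"
      using Suc.hyps by (simp add: power2_eq_square power3_eq_cube power4_eq_xxxx)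
    finally have "8 * real m ^ 4 + 4 * real m * E t (degree_power_sum 3) / real t
        \<le> 8 * real m ^ 4 + 48 * real m ^ 4 * real t" by simp
    also have "\<dots> \<le> 56 * real m ^ 4 * real (Suc t)" by (simp add: algebra_simps)
    finally have "(8 * real m ^ 4 + 4 * real m * E t (degree_power_sum 3) / real t) / (real (Suc t))\<^sup>2
        \<le> (56 * real m ^ 4 * real (Suc t)) / (real (Suc t))\<^sup>2"
      by (rule divide_right_mono) simp
    then show "(8 * real m ^ 4 + 4 * real m * E t (degree_power_sum 3) / real t) / (real (Suc t))\<^sup>2
        \<le> 56 * real m ^ 4 / real (Suc t)"
      by (simp add: power2_eq_square del: of_nat_Suc)
  qed
  finally show ?case
    by (simp add: harm_Suc distrib_left inverse_eq_divide del: of_nat_Suc)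
qed

text \<open>
  The curves are \<open>4 m\<^sup>2 harm t\<close> and \<open>(m\<^sup>2 + m) harm t\<close>. The upper drift needs only the factor \<open>2 m\<^sup>2\<close>,
  but the factor 4 also covers the initial value \<open>4 m\<^sup>2\<close>. Chebyshev's inequality then allows a
  deviation of \<open>m\<^sup>2 harm t\<close>, which leaves the positive multiple \<open>m harm t\<close> on the lower side.
\<close>

lemma prob_degree_square:
  assumes "t \<ge> 1"
  shows "measure_pmf.prob (hk_graph m p t)
      {G. degree_power_sum 2 G / real t \<ge> 5 * (real m)\<^sup>2 * harm t} \<le> 56 / harm t" (is "?upper")
    and "measure_pmf.prob (hk_graph m p t)
      {G. degree_power_sum 2 G / real t \<le> real m * harm t} \<le> 56 / harm t" (is "?lower")
proof -
  have m1: "m \<ge> 1" using m2 by simp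
  have markov: "measure_pmf.prob (hk_graph m p t) {G. X G \<ge> (real m)\<^sup>2 * harm t} \<le> 56 / harm t"
    if "E t (\<lambda>G. (max 0 (X G))\<^sup>2) \<le> 56 * real m ^ 4 * harm t" for X :: "multigraph \<Rightarrow> real"
  proof -
    let ?a = "(real m)\<^sup>2 * harm t :: real"
    have pos: "?a > 0" using m1 assms by simp
    have "measure_pmf.prob (hk_graph m p t) {G. X G \<ge> ?a}
        \<le> measure_pmf.prob (hk_graph m p t) {G \<in> space (hk_graph m p t). (max 0 (X G))\<^sup>2 \<ge> ?a\<^sup>2}"
    proof (rule measure_pmf.finite_measure_mono)
      show "{G. X G \<ge> ?a} \<subseteq> {G \<in> space (hk_graph m p t). (max 0 (X G))\<^sup>2 \<ge> ?a\<^sup>2}"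
        using pos by (auto intro!: power_mono)
    qed simp
    also have "\<dots> \<le> E t (\<lambda>G. (max 0 (X G))\<^sup>2) / ?a\<^sup>2"
      using pos
      by (intro integral_Markov_inequality_measure[where A = UNIV]
          integrable_measure_pmf_finite finite_hk_graph assms) (use m1 in auto)
    also have "\<dots> \<le> 56 * real m ^ 4 * harm t / ?a\<^sup>2"
      by (intro divide_right_mono that) simp
    also have "\<dots> = 56 / harm t"
      using m1 assms by (simp add: power2_eq_square power4_eq_xxxx field_simps)
    finally show ?thesis .
  qed
  have "E t (\<lambda>G. (max 0 (1 * (degree_power_sum 2 G / real t) + - 4 * (real m)\<^sup>2 * harm t))\<^sup>2)
      \<le> 56 * real m ^ 4 * harm t"
  proof (rule E_positive_part[OF _ _ _ assms])
    fix t G assume t: "t \<ge> 1" and G: "G \<in> set_pmf (hk_graph m p t)"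
    interpret hk_state m p t G by (rule state[OF t G])
    note [simp] = integrable_measure_pmf_finite[OF finite_step]
    have "measure_pmf.expectation (hk_step m p t G) (degree_power_sum 2) / real (Suc t)
        \<le> (Q 2 * (1 + 1 / real t) + 2 * (real m)\<^sup>2) / real (Suc t)"
      by (intro divide_right_mono expectation_step_degree_square) auto
    also have "\<dots> = Q 2 / real t + 2 * (real m)\<^sup>2 / real (Suc t)"
      using t by (simp add: field_simps)
    also have "\<dots> \<le> Q 2 / real t + 4 * (real m)\<^sup>2 / real (Suc t)"
      by (simp add: divide_right_mono)
    finally show "measure_pmf.expectation (hk_step m p t G)
        (\<lambda>G. 1 * (degree_power_sum 2 G / real (Suc t)) + - 4 * (real m)\<^sup>2 * harm (Suc t))
        \<le> 1 * (Q 2 / real t) + - 4 * (real m)\<^sup>2 * harm t"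
      by (simp add: harm_Suc distrib_left inverse_eq_divide del: of_nat_Suc)
  qed (simp_all add: harm_def)
  from markov[OF this] show ?upper by (simp add: algebra_simps)
  have "E t (\<lambda>G. (max 0 (- 1 * (degree_power_sum 2 G / real t)
        + ((real m)\<^sup>2 + real m) * harm t))\<^sup>2) \<le> 56 * real m ^ 4 * harm t"
  proof (rule E_positive_part[OF _ _ _ assms])
    fix t G assume t: "t \<ge> 1" and G: "G \<in> set_pmf (hk_graph m p t)"
    interpret hk_state m p t G by (rule state[OF t G])
    note [simp] = integrable_measure_pmf_finite[OF finite_step]
    have "Q 2 / real t + ((real m)\<^sup>2 + real m) / real (Suc t)
        = (Q 2 * (1 + 1 / real t) + ((real m)\<^sup>2 + real m)) / real (Suc t)"
      using t by (simp add: field_simps)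
    also have "\<dots> \<le> measure_pmf.expectation (hk_step m p t G) (degree_power_sum 2) / real (Suc t)"
      by (intro divide_right_mono expectation_step_degree_square) auto
    finally show "measure_pmf.expectation (hk_step m p t G)
        (\<lambda>G. - 1 * (degree_power_sum 2 G / real (Suc t)) + ((real m)\<^sup>2 + real m) * harm (Suc t))
        \<le> - 1 * (Q 2 / real t) + ((real m)\<^sup>2 + real m) * harm t"
      by (simp add: harm_Suc distrib_left inverse_eq_divide del: of_nat_Suc)
  next
    have "real m * 1 \<le> real m * real m" using m1 by (intro mult_left_mono) auto
    then show "4 * - 1 * (real m)\<^sup>2 + ((real m)\<^sup>2 + real m) * harm 1 \<le> 0"
      using zero_le_power2[of "real m"] by (simp add: harm_def power2_eq_square)
  qed simp
  from markov[OF this] show ?lower by (simp add: algebra_simps)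
qed

section \<open>The number of triangles is at least linear\<close>

lemma E_triangles:
  "t \<ge> 2 \<Longrightarrow> E t (\<lambda>G. (1 / 2) ^ card (triangles G)) \<le> (1 - p / 4) ^ (t - 2)"
proof (induction t rule: nat_induct_at_least)
  case base
  have "E 2 (\<lambda>G. (1 / 2) ^ card (triangles G)) \<le> E 2 (\<lambda>_. 1)"
    by (rule expectation_mono_finite[OF finite_hk_graph]) (auto intro: power_le_one)
  then show ?case by simp
next
  case (Suc t)
  then have t: "t \<ge> 1" by simp
  note [simp] = integrable_measure_pmf_finite[OF finite_hk_graph[OF t]]
  have "E (Suc t) (\<lambda>G. (1 / 2) ^ card (triangles G))
      \<le> E t (\<lambda>G. (1 / 2) ^ card (triangles G) * (1 - p / 4))"
    by (rule E_Suc_le[OF t])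
      (rule hk_state.expectation_step_triangles[OF state[OF t] loops[OF t] m2 Suc.hyps])
  also have "\<dots> = E t (\<lambda>G. (1 / 2) ^ card (triangles G)) * (1 - p / 4)" by simp
  also have "\<dots> \<le> (1 - p / 4) ^ (t - 2) * (1 - p / 4)"
    using p1 by (intro mult_right_mono Suc.IH) auto
  also have "\<dots> = (1 - p / 4) ^ (Suc t - 2)"
    using Suc.hyps by (simp only: Suc_diff_le power_Suc2)
  finally show ?case .
qed

text \<open>
  Markov's inequality for the exponential moment. The threshold \<open>p t / 8\<close> costs a factor
  \<open>exp (p t / 8)\<close>, which the decay \<open>exp (- p (t - 2) / 4)\<close> of the moment outweighs.
\<close>

lemma prob_few_triangles:
  assumes t: "t \<ge> 2"
  shows "measure_pmf.prob (hk_graph m p t) {G. real (card (triangles G)) \<le> p * real t / 8}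
    \<le> exp (p / 2) * exp (- p / 8) ^ t"
proof -
  let ?a = "exp (- (p * real t / 8))"
  have half: "exp (- real n) \<le> (1 / 2) ^ n" for n :: nat
  proof -
    have "(2::real) \<le> exp 1" using exp_ge_add_one_self[of 1] by simp
    then have "exp (- 1) \<le> (1 / 2 :: real)" by (simp add: exp_minus field_simps)
    then have "exp (- 1) ^ n \<le> (1 / 2 :: real) ^ n" by (rule power_mono) simp
    then show ?thesis by (simp flip: exp_of_nat_mult)
  qed
  have "measure_pmf.prob (hk_graph m p t) {G. real (card (triangles G)) \<le> p * real t / 8}
      \<le> measure_pmf.prob (hk_graph m p t)
          {G \<in> space (hk_graph m p t). (1 / 2) ^ card (triangles G) \<ge> ?a}"
  proof (rule measure_pmf.finite_measure_mono)
    show "{G. real (card (triangles G)) \<le> p * real t / 8}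
        \<subseteq> {G \<in> space (hk_graph m p t). (1 / 2) ^ card (triangles G) \<ge> ?a}"
    proof clarsimp
      fix G assume "real (card (triangles G)) * 8 \<le> p * real t"
      then have "?a \<le> exp (- real (card (triangles G)))" by simp
      also note half
      finally show "?a \<le> (1 / 2) ^ card (triangles G)" .
    qed
  qed simp
  also have "\<dots> \<le> E t (\<lambda>G. (1 / 2) ^ card (triangles G)) / ?a"
    using t by (intro integral_Markov_inequality_measure[where A = UNIV]
          integrable_measure_pmf_finite finite_hk_graph) auto
  also have "\<dots> \<le> (1 - p / 4) ^ (t - 2) / ?a"
    by (intro divide_right_mono E_triangles t) simp
  also have "\<dots> \<le> exp (- p / 4) ^ (t - 2) / ?a"
    using p1 exp_ge_add_one_self[of "- p / 4"] by (intro divide_right_mono power_mono) auto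
  also have "\<dots> = exp (p / 2) * exp (- p / 8) ^ t"
    using t by (simp add: of_nat_diff field_simps flip: exp_of_nat_mult exp_diff exp_add)
  finally show ?thesis .
qed

section \<open>The clustering coefficient\<close>

lemma cherries_eq:
  assumes "t \<ge> 1" "G \<in> set_pmf (hk_graph m p t)"
  shows "real (cherries G) = (degree_power_sum 2 G - 2 * real m * real t) / 2"
proof -
  interpret hk_state m p t G by (rule state[OF assms])
  have choose: "real (n choose 2) = (real n ^ 2 - real n) / 2" for n
    by (induction n) (auto simp: numeral_2_eq_2 field_simps)
  have "real (cherries G) = (\<Sum>v\<in>verts G. (d v ^ 2 - d v) / 2)"
    by (simp add: cherries_def choose)
  then show ?thesis
    by (simp add: degree_sum degree_power_sum_def sum_subtractf flip: sum_divide_distrib)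
qed

text \<open>
  Subtracting \<open>2 m t\<close> in \<open>cherries_eq\<close> costs at most half of \<open>m t harm t\<close> once \<open>harm t \<ge> 4\<close>; this and
  \<open>ln t \<le> harm t \<le> 2 ln t\<close> account for the constants.
\<close>

lemma global_clustering_bounds:
  assumes t: "t \<ge> 1" "G \<in> set_pmf (hk_graph m p t)" and h4: "harm t \<ge> (4::real)" and ln1: "ln (real t) \<ge> 1"
    and p: "p > 0"
    and upper: "degree_power_sum 2 G / real t < 5 * (real m)\<^sup>2 * harm t"
    and lower: "degree_power_sum 2 G / real t > real m * harm t"
    and many: "real (card (triangles G)) > p * real t / 8"
  shows "3 * p / (40 * (real m)\<^sup>2) / ln (real t) \<le> global_clustering G"
    and "global_clustering G \<le> 12 * real m / ln (real t)"
proof -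
  let ?D = "real (card (triangles G))" and ?C = "real (cherries G)" and ?l = "ln (real t)"
  have m1: "m \<ge> 1" using m2 by simp
  have harm_ge: "harm t \<ge> ?l"
    using ln_le_harm[of t] t(1) by (smt (verit) ln_mono of_nat_1 of_nat_mono)
  have harm_le: "harm t \<le> 2 * ?l"
  proof -
    obtain n where n: "t = Suc n" using t(1) by (cases t) auto
    have "harm (Suc n) - ln (real (Suc n)) \<le> harm (Suc 0) - ln (real (Suc 0))"
      using decseq_harm_diff_ln by (simp add: decseq_def del: of_nat_Suc)
    then show ?thesis using ln1 unfolding n by (simp add: harm_def)
  qed
  have C_upper: "?C \<le> 5 * (real m)\<^sup>2 * real t * ?l"
  proof -
    have "degree_power_sum 2 G \<le> 5 * (real m)\<^sup>2 * harm t * real t"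
      using upper t(1) by (simp add: field_simps)
    also have "\<dots> \<le> 5 * (real m)\<^sup>2 * (2 * ?l) * real t"
      by (intro mult_right_mono mult_left_mono harm_le) auto
    also have "\<dots> = 2 * (5 * (real m)\<^sup>2 * real t * ?l)" by simp
    finally have "degree_power_sum 2 G \<le> 2 * (5 * (real m)\<^sup>2 * real t * ?l)" .
    then have "degree_power_sum 2 G - 2 * real m * real t \<le> 2 * (5 * (real m)\<^sup>2 * real t * ?l)"
      by (rule order_trans[rotated]) simp
    then show ?thesis unfolding cherries_eq[OF t] by simp
  qed
  have C_lower: "real m * real t * ?l / 4 \<le> ?C"
  proof -
    have "real m * harm t * real t \<le> degree_power_sum 2 G"
      using lower t(1) by (simp add: field_simps)
    moreover have "real m * real t * 4 \<le> real m * real t * harm t"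
      by (intro mult_left_mono h4) auto
    moreover have "real m * real t * ?l \<le> real m * real t * harm t"
      by (intro mult_left_mono harm_ge) auto
    ultimately show ?thesis unfolding cherries_eq[OF t] by (simp add: algebra_simps)
  qed
  have pos: "0 < real m * real t * ?l / 4"
  proof -
    have "0 < ?l" using ln1 by linarith
    moreover have "0 < real m" "0 < real t" using m1 t(1) by simp_all
    ultimately show ?thesis by (intro divide_pos_pos mult_pos_pos) simp_all
  qed
  have "3 * p / (40 * (real m)\<^sup>2) / ?l = 3 * (p * real t / 8) / (5 * (real m)\<^sup>2 * real t * ?l)"
    using t(1) by (simp add: field_simps)
  also have "\<dots> \<le> 3 * ?D / ?C"
    using many C_upper pos C_lower p by (intro frac_le) auto
  finally show "3 * p / (40 * (real m)\<^sup>2) / ?l \<le> global_clustering G"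
    by (simp add: global_clustering_def)
  have "card (triangles G) \<le> m\<^sup>2 * t" by (rule card_triangles_le[OF t])
  then have "?D \<le> (real m)\<^sup>2 * real t" by (metis of_nat_le_iff of_nat_mult of_nat_power)
  then have "3 * ?D / ?C \<le> 3 * ((real m)\<^sup>2 * real t) / (real m * real t * ?l / 4)"
    using pos C_lower by (intro frac_le) auto
  also have "\<dots> = 12 * real m / ?l"
    using t(1) m1 by (simp add: power2_eq_square field_simps)
  finally show "global_clustering G \<le> 12 * real m / ?l" by (simp add: global_clustering_def)
qed

lemma prob_global_clustering:
  assumes t: "t \<ge> 2" and h4: "harm t \<ge> (4::real)" and ln1: "ln (real t) \<ge> 1" and p: "p > 0"
  shows "1 - (56 / harm t + 56 / harm t + exp (p / 2) * exp (- p / 8) ^ t)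
    \<le> measure_pmf.prob (hk_graph m p t) {G. 3 * p / (40 * (real m)\<^sup>2) / ln (real t) \<le> global_clustering G
        \<and> global_clustering G \<le> 12 * real m / ln (real t)}" (is "1 - ?b \<le> measure_pmf.prob _ ?good")
proof -
  let ?P = "measure_pmf.prob (hk_graph m p t)"
  let ?A = "{G. degree_power_sum 2 G / real t \<ge> 5 * (real m)\<^sup>2 * harm t}"
  let ?B = "{G. degree_power_sum 2 G / real t \<le> real m * harm t}"
  let ?C = "{G. real (card (triangles G)) \<le> p * real t / 8}"
  have t1: "t \<ge> 1" using t by simp
  have "?P (- ?good) \<le> ?P (?A \<union> ?B \<union> ?C)"
  proof (rule measure_pmf.finite_measure_mono_AE)
    show "AE G in hk_graph m p t. G \<in> - ?good \<longrightarrow> G \<in> ?A \<union> ?B \<union> ?C"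
      using global_clustering_bounds[OF t1 _ h4 ln1 p] by (force simp: AE_measure_pmf_iff)
  qed simp
  also have "\<dots> \<le> ?P ?A + ?P ?B + ?P ?C"
    by (rule order_trans[OF measure_Un_le add_right_mono[OF measure_Un_le]]) simp_all
  also have "\<dots> \<le> ?b"
    by (intro add_mono prob_degree_square prob_few_triangles t t1)
  also have "?P (- ?good) = 1 - ?P ?good"
    by (simp add: Compl_eq_Diff_UNIV measure_pmf.prob_compl[simplified])
  finally show ?thesis by linarith
qed

end

theorem theorem2:
  fixes m :: nat and p :: real
  assumes "m \<ge> 2" and "0 < p" and "p < 1"
  shows "\<exists>b1 b2 :: real. b1 > 0 \<and> b2 > 0 \<and>
    (\<lambda>t. measure_pmf.prob (hk_graph m p t)
            {G. b1 / ln (real t) \<le> global_clustering G \<and> global_clustering G \<le> b2 / ln (real t)})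
      \<longlonglongrightarrow> 1"
proof (intro exI conjI)
  interpret hk_process m p by unfold_locales (use assms in auto)
  show "0 < 3 * p / (40 * (real m)\<^sup>2)" "0 < 12 * real m" using assms by auto
  have h: "eventually (\<lambda>t. harm t \<ge> (4::real)) sequentially"
    using harm_at_top by (auto simp: filterlim_at_top)
  have l: "eventually (\<lambda>t. ln (real t) \<ge> 1) sequentially"
    using filterlim_compose[OF ln_at_top filterlim_real_sequentially] by (auto simp: filterlim_at_top)
  have "(\<lambda>t. 1 - (56 / harm t + 56 / harm t + exp (p / 2) * exp (- p / 8) ^ t)) \<longlonglongrightarrow>
      1 - (0 + 0 + exp (p / 2) * 0)"
    by (intro tendsto_intros tendsto_divide_0[OF tendsto_const] LIMSEQ_realpow_zero
        filterlim_at_top_imp_at_infinity harm_at_top) (use assms in auto)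
  then have low: "(\<lambda>t. 1 - (56 / harm t + 56 / harm t + exp (p / 2) * exp (- p / 8) ^ t)) \<longlonglongrightarrow> 1"
    by simp
  show "(\<lambda>t. measure_pmf.prob (hk_graph m p t)
            {G. 3 * p / (40 * (real m)\<^sup>2) / ln (real t) \<le> global_clustering G
              \<and> global_clustering G \<le> 12 * real m / ln (real t)}) \<longlonglongrightarrow> 1"
  proof (rule tendsto_sandwich[OF _ _ low tendsto_const])
    show "eventually (\<lambda>t. 1 - (56 / harm t + 56 / harm t + exp (p / 2) * exp (- p / 8) ^ t)
        \<le> measure_pmf.prob (hk_graph m p t)
            {G. 3 * p / (40 * (real m)\<^sup>2) / ln (real t) \<le> global_clustering G
              \<and> global_clustering G \<le> 12 * real m / ln (real t)}) sequentially"
      using h l eventually_ge_at_top[of 2]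
      by eventually_elim (rule prob_global_clustering, use assms in auto)
  qed simp
qed

end
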